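(* (1) There exists a finite non-associative and non-commutative alternative centrally essential ring. (2) There exists a finite non-commutative and non-alternative centrally essential ring.
   Context: All rings are unital but not necessarily associative. For a ring $R$, $(a,b,c)=(ab)c-a(bc)$ is the associator and $[a,b]=ab-ba$ the commutator. The associative center is $N(R)=\{x\in R : (x,a,b)=(a,x,b)=(a,b,x)=0\ \forall a,b\in R\}$, the commutative center is $K(R)=\{x\in R : [x,a]=0\ \forall a\in R\}$, and the center is $Z(R)=N(R)\cap K(R)$. A ring $R$ is centrally essential if $Z(R)r\cap Z(R)\neq 0$ for every nonzero $r\in R$. A ring $R$ is alternative if $(a,a,b)=0=(a,b,b)$ for all $a,b\in R$. *)

theory Defs
  imports "HOL-Algebra.Ring"
begin

text \<open>
  Unital, not necessarily associative rings, on the carrier-based ring records of HOL-Algebra.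
  The library locale \<open>ring\<close> cannot be used, since it includes associativity of multiplication.
\<close>

locale nonassoc_ring = abelian_group R for R (structure) +
  assumes mult_closed: "\<lbrakk>x \<in> carrier R; y \<in> carrier R\<rbrakk> \<Longrightarrow> x \<otimes> y \<in> carrier R"
    and unit_closed: "\<one> \<in> carrier R"
    and left_unit: "x \<in> carrier R \<Longrightarrow> \<one> \<otimes> x = x"
    and right_unit: "x \<in> carrier R \<Longrightarrow> x \<otimes> \<one> = x"
    and left_distrib: "\<lbrakk>x \<in> carrier R; y \<in> carrier R; z \<in> carrier R\<rbrakk>
      \<Longrightarrow> (x \<oplus> y) \<otimes> z = x \<otimes> z \<oplus> y \<otimes> z"
    and right_distrib: "\<lbrakk>x \<in> carrier R; y \<in> carrier R; z \<in> carrier R\<rbrakk>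
      \<Longrightarrow> z \<otimes> (x \<oplus> y) = z \<otimes> x \<oplus> z \<otimes> y"

definition ring_associator :: "('a, 'm) ring_scheme \<Rightarrow> 'a \<Rightarrow> 'a \<Rightarrow> 'a \<Rightarrow> 'a" where
  "ring_associator R a b c = ((a \<otimes>\<^bsub>R\<^esub> b) \<otimes>\<^bsub>R\<^esub> c) \<ominus>\<^bsub>R\<^esub> (a \<otimes>\<^bsub>R\<^esub> (b \<otimes>\<^bsub>R\<^esub> c))"

definition ring_commutator :: "('a, 'm) ring_scheme \<Rightarrow> 'a \<Rightarrow> 'a \<Rightarrow> 'a" where
  "ring_commutator R a b = (a \<otimes>\<^bsub>R\<^esub> b) \<ominus>\<^bsub>R\<^esub> (b \<otimes>\<^bsub>R\<^esub> a)"

definition associative_center :: "('a, 'm) ring_scheme \<Rightarrow> 'a set" where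
  "associative_center R = {x \<in> carrier R. \<forall>a\<in>carrier R. \<forall>b\<in>carrier R.
     ring_associator R x a b = \<zero>\<^bsub>R\<^esub> \<and> ring_associator R a x b = \<zero>\<^bsub>R\<^esub>
     \<and> ring_associator R a b x = \<zero>\<^bsub>R\<^esub>}"

definition commutative_center :: "('a, 'm) ring_scheme \<Rightarrow> 'a set" where
  "commutative_center R = {x \<in> carrier R. \<forall>a\<in>carrier R. ring_commutator R x a = \<zero>\<^bsub>R\<^esub>}"

definition ring_center :: "('a, 'm) ring_scheme \<Rightarrow> 'a set" where
  "ring_center R = associative_center R \<inter> commutative_center R"

text \<open>The condition \<open>Z(R)r \<inter> Z(R) \<noteq> 0\<close> compares with the zero subgroup, not with the empty set.\<close>

definition centrally_essential :: "('a, 'm) ring_scheme \<Rightarrow> bool" where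
  "centrally_essential R \<longleftrightarrow> (\<forall>r\<in>carrier R. r \<noteq> \<zero>\<^bsub>R\<^esub> \<longrightarrow>
     {z \<otimes>\<^bsub>R\<^esub> r |z. z \<in> ring_center R} \<inter> ring_center R \<noteq> {\<zero>\<^bsub>R\<^esub>})"

definition alternative_ring :: "('a, 'm) ring_scheme \<Rightarrow> bool" where
  "alternative_ring R \<longleftrightarrow> (\<forall>a\<in>carrier R. \<forall>b\<in>carrier R.
     ring_associator R a a b = \<zero>\<^bsub>R\<^esub> \<and> ring_associator R a b b = \<zero>\<^bsub>R\<^esub>)"

definition associative_ring :: "('a, 'm) ring_scheme \<Rightarrow> bool" where
  "associative_ring R \<longleftrightarrow> (\<forall>a\<in>carrier R. \<forall>b\<in>carrier R. \<forall>c\<in>carrier R.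
     (a \<otimes>\<^bsub>R\<^esub> b) \<otimes>\<^bsub>R\<^esub> c = a \<otimes>\<^bsub>R\<^esub> (b \<otimes>\<^bsub>R\<^esub> c))"

definition commutative_ring :: "('a, 'm) ring_scheme \<Rightarrow> bool" where
  "commutative_ring R \<longleftrightarrow> (\<forall>a\<in>carrier R. \<forall>b\<in>carrier R. a \<otimes>\<^bsub>R\<^esub> b = b \<otimes>\<^bsub>R\<^esub> a)"

end

theory Submission
  imports Defs "HOL-Library.Numeral_Type" "HOL-Library.Product_Plus"
begin

text \<open>
  If twice every commutator and twice every associator vanishes, then every element \<open>r + r\<close> is
  central. If moreover \<open>r + r = 0\<close> only when \<open>r\<close> is itself of the form \<open>s + s\<close>, then the ring
  is centrally essential: multiply \<open>r\<close> by \<open>1 + 1\<close> or by \<open>1\<close>. Hence every algebra that is free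
  over \<open>\<int>/4\<close> and becomes commutative and associative modulo 2 is centrally essential. For (1) the
  algebra is a degenerate Cayley--Dickson double \<open>(a, b)(c, d) = (ac, da + bc*)\<close> of the exterior
  algebra on two generators; for (2) it has basis \<open>1, x, y\<close> and \<open>xy = 2\<close> as its only nonzero
  product of generators.
\<close>

lemma (in abelian_group) minus_eq_zero_iff:
  assumes "x \<in> carrier G" "y \<in> carrier G"
  shows "x \<ominus> y = \<zero> \<longleftrightarrow> x = y"
  using assms by (metis add.inv_closed add.inv_equality add.inv_inv minus_eq r_neg)

text \<open>Separates arithmetic from carrier-based records: computations use class-based addition
  on a finite type, and the injection \<open>enc\<close> only transports the result to a ring on
  natural numbers.\<close>

locale finite_nonassoc_alg =
  fixes mul :: "'a::{finite,ab_group_add} \<Rightarrow> 'a \<Rightarrow> 'a" (infixl "\<bullet>" 70)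
    and unit :: 'a
    and enc :: "'a \<Rightarrow> nat"
  assumes inj_enc: "inj enc"
    and unit_mul [simp]: "unit \<bullet> x = x"
    and mul_unit [simp]: "x \<bullet> unit = x"
    and add_mul: "(x + y) \<bullet> z = x \<bullet> z + y \<bullet> z"
    and mul_add: "z \<bullet> (x + y) = z \<bullet> x + z \<bullet> y"
begin

definition nat_copy :: "nat ring" where
  "nat_copy = \<lparr>carrier = range enc, mult = \<lambda>x y. enc (the_inv enc x \<bullet> the_inv enc y), one = enc unit,
     zero = enc 0, add = \<lambda>x y. enc (the_inv enc x + the_inv enc y)\<rparr>"

lemma nat_copy_simps [simp]:
  "carrier nat_copy = range enc"
  "\<one>\<^bsub>nat_copy\<^esub> = enc unit"
  "\<zero>\<^bsub>nat_copy\<^esub> = enc 0"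
  "enc x \<otimes>\<^bsub>nat_copy\<^esub> enc y = enc (x \<bullet> y)"
  "enc x \<oplus>\<^bsub>nat_copy\<^esub> enc y = enc (x + y)"
  by (simp_all add: nat_copy_def the_inv_f_f inj_enc)

lemma enc_eq_iff [simp]: "enc x = enc y \<longleftrightarrow> x = y"
  using inj_enc by (simp add: inj_eq)

sublocale copy: nonassoc_ring nat_copy
proof -
  have "abelian_group nat_copy"
  proof (rule abelian_groupI)
    fix x assume "x \<in> carrier nat_copy"
    then obtain a where "x = enc a" by auto
    then show "\<exists>y\<in>carrier nat_copy. y \<oplus>\<^bsub>nat_copy\<^esub> x = \<zero>\<^bsub>nat_copy\<^esub>"
      by (intro bexI [of _ "enc (- a)"]) auto
  qed (auto simp: algebra_simps)
  then show "nonassoc_ring nat_copy"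
    by (intro nonassoc_ring.intro nonassoc_ring_axioms.intro)
      (auto simp: add_mul mul_add)
qed

lemma finite_copy: "finite (carrier nat_copy)"
  by simp

lemma associator_eq_zero_iff:
  "ring_associator nat_copy (enc a) (enc b) (enc c) = enc 0 \<longleftrightarrow> (a \<bullet> b) \<bullet> c = a \<bullet> (b \<bullet> c)"
  using copy.minus_eq_zero_iff by (simp add: ring_associator_def)

lemma commutator_eq_zero_iff:
  "ring_commutator nat_copy (enc a) (enc b) = enc 0 \<longleftrightarrow> a \<bullet> b = b \<bullet> a"
  using copy.minus_eq_zero_iff by (simp add: ring_commutator_def)

lemma associative_copy_iff:
  "associative_ring nat_copy \<longleftrightarrow> (\<forall>a b c. (a \<bullet> b) \<bullet> c = a \<bullet> (b \<bullet> c))"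
  by (simp add: associative_ring_def)

lemma commutative_copy_iff:
  "commutative_ring nat_copy \<longleftrightarrow> (\<forall>a b. a \<bullet> b = b \<bullet> a)"
  by (simp add: commutative_ring_def)

lemma alternative_copy_iff:
  "alternative_ring nat_copy \<longleftrightarrow>
     (\<forall>a b. (a \<bullet> a) \<bullet> b = a \<bullet> (a \<bullet> b) \<and> (a \<bullet> b) \<bullet> b = a \<bullet> (b \<bullet> b))"
  by (simp add: alternative_ring_def associator_eq_zero_iff)

lemma center_copy_iff:
  "enc x \<in> ring_center nat_copy \<longleftrightarrow>
     (\<forall>a b. (x \<bullet> a) \<bullet> b = x \<bullet> (a \<bullet> b) \<and> (a \<bullet> x) \<bullet> b = a \<bullet> (x \<bullet> b)
        \<and> (a \<bullet> b) \<bullet> x = a \<bullet> (b \<bullet> x) \<and> x \<bullet> a = a \<bullet> x)"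
  by (auto simp: ring_center_def associative_center_def commutative_center_def
      associator_eq_zero_iff commutator_eq_zero_iff)

lemma centrally_essential_copy:
  assumes comm: "\<And>a b. a \<bullet> b + a \<bullet> b = b \<bullet> a + b \<bullet> a"
    and assoc: "\<And>a b c. (a \<bullet> b) \<bullet> c + (a \<bullet> b) \<bullet> c = a \<bullet> (b \<bullet> c) + a \<bullet> (b \<bullet> c)"
    and double: "\<And>a :: 'a. a + a = 0 \<Longrightarrow> \<exists>b. a = b + b"
  shows "centrally_essential nat_copy"
proof -
  \<comment> \<open>Once the sums are distributed, every centrality condition on
    \<open>x + x\<close> is an instance of \<open>comm\<close> or \<open>assoc\<close>.\<close>
  have central: "enc (x + x) \<in> ring_center nat_copy" for x
    unfolding center_copy_iff add_mul mul_add using comm assoc by metis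
  have unit_central: "enc unit \<in> ring_center nat_copy"
    by (simp add: center_copy_iff)
  have "\<exists>z. enc z \<in> ring_center nat_copy \<and> enc (z \<bullet> x) \<in> ring_center nat_copy \<and> z \<bullet> x \<noteq> 0"
    if "x \<noteq> 0" for x
  proof (cases "x + x = 0")
    case True
    then obtain b where "x = b + b" using double by blast
    with that central unit_central show ?thesis by (intro exI [of _ unit]) auto
  next
    case False
    \<comment> \<open>The product of \<open>unit + unit\<close> with \<open>x\<close> is
      \<open>x + x\<close>, which is central and here nonzero.\<close>
    with central show ?thesis
      by (intro exI [of _ "unit + unit"]) (simp add: add_mul)
  qed
  then show ?thesis
    unfolding centrally_essential_def by simp
      (metis (mono_tags, lifting) Int_iff enc_eq_iff mem_Collect_eq nat_copy_simps(4) singletonD)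
qed

end

text \<open>The type \<open>4\<close> is the ring of integers modulo 4. As a rewrite rule this
  removes what remains of the doubled commutators and associators.\<close>

lemma mul_four: "x * 4 = 0" for x :: 4
proof -
  have "(4 :: 4) = 0" by simp
  then show ?thesis by (simp only: mult_zero_right)
qed

text \<open>Only 0 and 2 = 1 + 1 are annihilated by doubling modulo 4. Applied coordinatewise, this
  gives the hypothesis \<open>double\<close> for both algebras.\<close>

lemma double_eq_zero_4:
  fixes x :: 4
  assumes "x + x = 0"
  shows "\<exists>y. x = y + y"
proof (cases x)
  case (of_int z)
  then have "z \<in> {0, 1, 2, 3}" by auto
  then have "x = 0 \<or> x = 1 \<or> x = 2 \<or> x = 3" using of_int by auto
  with assms have "x = 0 + 0 \<or> x = 1 + 1" by auto
  then show ?thesis by blast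
qed

text \<open>Coordinates with respect to \<open>1, i, j, ij\<close>, where \<open>i\<^sup>2 = j\<^sup>2 = 0\<close> and \<open>ji = - ij\<close>.\<close>

type_synonym ext = "4 \<times> 4 \<times> 4 \<times> 4"

fun ext_mul :: "ext \<Rightarrow> ext \<Rightarrow> ext" where
  "ext_mul (a, b, c, d) (a', b', c', d') =
     (a * a', a * b' + b * a', a * c' + c * a', a * d' + b * c' - c * b' + d * a')"

text \<open>The anti-automorphism that negates both generators; it sends ij to ji = -ij, whence the
  sign on \<open>d\<close>.\<close>

fun ext_conj :: "ext \<Rightarrow> ext" where
  "ext_conj (a, b, c, d) = (a, - b, - c, - d)"

lemma ext_pair_cases:
  obtains a b c d a' b' c' d' where "(x :: ext \<times> ext) = ((a, b, c, d), (a', b', c', d'))"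
  by (cases x) auto

fun cd_mul :: "ext \<times> ext \<Rightarrow> ext \<times> ext \<Rightarrow> ext \<times> ext" where
  "cd_mul (a, b) (c, d) = (ext_mul a c, ext_mul d a + ext_mul b (ext_conj c))"

fun triple_mul :: "4 \<times> 4 \<times> 4 \<Rightarrow> 4 \<times> 4 \<times> 4 \<Rightarrow> 4 \<times> 4 \<times> 4" where
  "triple_mul (a, b, c) (a', b', c') = (a * a' + 2 * b * c', a * b' + b * a', a * c' + c * a')"

lemma ex_enc: "\<exists>enc :: 'a::finite \<Rightarrow> nat. inj enc"
  using finite_imp_inj_to_nat_seg [OF finite_class.finite_UNIV] by blast

lemma alternative_example:
  "\<exists>R :: nat ring. nonassoc_ring R \<and> finite (carrier R) \<and> \<not> associative_ring R
     \<and> \<not> commutative_ring R \<and> alternative_ring R \<and> centrally_essential R"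
proof -
  obtain enc :: "ext \<times> ext \<Rightarrow> nat" where "inj enc"
    using ex_enc by blast
  then interpret finite_nonassoc_alg cd_mul "((1, 0, 0, 0), 0)" enc
    by unfold_locales (auto simp: zero_prod_def algebra_simps)
  \<comment> \<open>For l = (0, 1) one has (li)j = (0, ij) but l(ij) = (0, -ij), and 1 differs from
    -1 modulo 4.\<close>
  have nonassoc: "cd_mul (cd_mul (0, (1, 0, 0, 0)) ((0, 1, 0, 0), 0)) ((0, 0, 1, 0), 0)
      \<noteq> cd_mul (0, (1, 0, 0, 0)) (cd_mul ((0, 1, 0, 0), 0) ((0, 0, 1, 0), 0))"
    by (simp add: zero_prod_def)
  have noncomm: "cd_mul ((0, 1, 0, 0), 0) ((0, 0, 1, 0), 0)
      \<noteq> cd_mul ((0, 0, 1, 0), 0) ((0, 1, 0, 0), 0)"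
    by (simp add: zero_prod_def)
  \<comment> \<open>Conceptually, the exterior algebra is associative and the sum and product of an
    element with its conjugate are scalars; the proof expands coordinates.\<close>
  have alt: "cd_mul (cd_mul a a) b = cd_mul a (cd_mul a b)"
    "cd_mul (cd_mul a b) b = cd_mul a (cd_mul b b)" for a b
    by (cases a rule: ext_pair_cases; cases b rule: ext_pair_cases; simp add: algebra_simps)+
  have "centrally_essential nat_copy"
  proof (rule centrally_essential_copy)
    \<comment> \<open>Signs and conjugation disappear modulo 2, so doubled differences are multiples
      of 4.\<close>
    show "cd_mul a b + cd_mul a b = cd_mul b a + cd_mul b a" for a b
      by (cases a rule: ext_pair_cases; cases b rule: ext_pair_cases)
        (simp add: algebra_simps mul_four)
    show "cd_mul (cd_mul a b) c + cd_mul (cd_mul a b) c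
        = cd_mul a (cd_mul b c) + cd_mul a (cd_mul b c)" for a b c
      by (cases a rule: ext_pair_cases; cases b rule: ext_pair_cases;
          cases c rule: ext_pair_cases) (simp add: algebra_simps mul_four)
    show "\<exists>b. a = b + b" if "a + a = 0" for a :: "ext \<times> ext"
      using that double_eq_zero_4 by (cases a rule: ext_pair_cases) (force simp: zero_prod_def)
  qed
  with nonassoc noncomm alt show ?thesis
    using copy.nonassoc_ring_axioms finite_copy associative_copy_iff commutative_copy_iff
      alternative_copy_iff by blast
qed

lemma nonalternative_example:
  "\<exists>R :: nat ring. nonassoc_ring R \<and> finite (carrier R)
     \<and> \<not> commutative_ring R \<and> \<not> alternative_ring R \<and> centrally_essential R"
proof -
  obtain enc :: "4 \<times> 4 \<times> 4 \<Rightarrow> nat" where "inj enc"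
    using ex_enc by blast
  then interpret finite_nonassoc_alg triple_mul "(1, 0, 0)" enc
    by unfold_locales (auto simp: algebra_simps)
  \<comment> \<open>Here xy = 2 but yx = 0, and (xx)y = 0 but x(xy) = 2x.\<close>
  have x: "triple_mul (0, 1, 0) (0, 0, 1) \<noteq> triple_mul (0, 0, 1) (0, 1, 0)"
    "triple_mul (triple_mul (0, 1, 0) (0, 1, 0)) (0, 0, 1) \<noteq>
     triple_mul (0, 1, 0) (triple_mul (0, 1, 0) (0, 0, 1))"
    by simp_all
  have "centrally_essential nat_copy"
  proof (rule centrally_essential_copy)
    show "triple_mul a b + triple_mul a b = triple_mul b a + triple_mul b a" for a b
      by (cases a; cases b) (simp add: algebra_simps mul_four)
    show "triple_mul (triple_mul a b) c + triple_mul (triple_mul a b) c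
        = triple_mul a (triple_mul b c) + triple_mul a (triple_mul b c)" for a b c
      by (cases a; cases b; cases c) (simp add: algebra_simps mul_four)
    show "\<exists>b. a = b + b" if "a + a = 0" for a :: "4 \<times> 4 \<times> 4"
      using that double_eq_zero_4 by (cases a) (force simp: zero_prod_def)
  qed
  with x show ?thesis
    using copy.nonassoc_ring_axioms finite_copy commutative_copy_iff alternative_copy_iff by blast
qed

theorem theorem1p5:
  shows "(\<exists>R :: nat ring. nonassoc_ring R \<and> finite (carrier R) \<and> \<not> associative_ring R
            \<and> \<not> commutative_ring R \<and> alternative_ring R \<and> centrally_essential R)
       \<and> (\<exists>R :: nat ring. nonassoc_ring R \<and> finite (carrier R)
            \<and> \<not> commutative_ring R \<and> \<not> alternative_ring R \<and> centrally_essential R)"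
  using alternative_example nonalternative_example by blast

end
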